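(* $f(4)=8$. That is, every $4$-anti-traceable oriented graph on at least $8$ vertices has a hamiltonian anti-directed path, and there exists a $4$-anti-traceable oriented graph on $7$ vertices with no hamiltonian anti-directed path.
   Context: An oriented graph is a digraph obtained by orienting the edges of a simple undirected graph. An oriented path $x_1\dots x_p$ is anti-directed if every two consecutive arcs have opposite orientations. A digraph is anti-traceable if it has an anti-directed path through all its vertices (a hamiltonian anti-directed path), and $k$-anti-traceable if it has at least $k$ vertices and every induced subdigraph on $k$ vertices is anti-traceable. $f(k)$ denotes the minimum integer $f\ge k$ such that every $k$-anti-traceable oriented graph on at least $f$ vertices is anti-traceable. *)

theory Defs
  imports "Graph_Theory.Digraph_Component"
begin

text \<open>\<open>E\<close> is the edge set of a simple undirected graph on \<open>verts G\<close>; the bijection says that \<open>G\<close>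
  arises from it by replacing each edge by exactly one arc joining its two endpoints.\<close>
definition oriented_graph :: "('a, 'b) pre_digraph \<Rightarrow> bool" where
  "oriented_graph G \<longleftrightarrow> finite (verts G) \<and>
     (\<exists>E. E \<subseteq> {e. e \<subseteq> verts G \<and> card e = 2} \<and>
          bij_betw (\<lambda>a. {tail G a, head G a}) (arcs G) E)"

lemma oriented_graph_iff:
  "oriented_graph G \<longleftrightarrow> digraph G \<and> (\<forall>u v. u \<rightarrow>\<^bsub>G\<^esub> v \<longrightarrow> \<not> v \<rightarrow>\<^bsub>G\<^esub> u)"
proof
  assume "oriented_graph G"
  then obtain E where fin: "finite (verts G)"
    and E: "E \<subseteq> {e. e \<subseteq> verts G \<and> card e = 2}"
    and bij: "bij_betw (\<lambda>a. {tail G a, head G a}) (arcs G) E"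
    unfolding oriented_graph_def by blast
  have "finite E"
    by (rule finite_subset[of _ "Pow (verts G)"]) (use E fin in auto)
  then have fin_arcs: "finite (arcs G)" using bij bij_betw_finite by blast
  have ends: "{tail G a, head G a} \<subseteq> verts G \<and> card {tail G a, head G a} = 2"
    if "a \<in> arcs G" for a
    using bij_betw_apply[OF bij that] E by blast
  have neq: "tail G a \<noteq> head G a" if "a \<in> arcs G" for a
    using ends[OF that] by auto
  have inj: "a = b" if "a \<in> arcs G" "b \<in> arcs G" "{tail G a, head G a} = {tail G b, head G b}" for a b
    using bij that unfolding bij_betw_def inj_on_def by blast
  have "digraph G"
  proof
    fix a b assume "a \<in> arcs G" "b \<in> arcs G" "arc_to_ends G a = arc_to_ends G b"
    then show "a = b" by (intro inj) (simp_all add: arc_to_ends_def)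
  qed (use ends fin fin_arcs neq in blast)+
  moreover have False if "u \<rightarrow>\<^bsub>G\<^esub> v" "v \<rightarrow>\<^bsub>G\<^esub> u" for u v
  proof -
    from that obtain a b where a: "a \<in> arcs G" "tail G a = u" "head G a = v"
      and b: "b \<in> arcs G" "tail G b = v" "head G b = u"
      by (auto simp: arcs_ends_conv)
    then have "a = b" by (intro inj) (simp_all add: insert_commute)
    with a b neq[OF a(1)] show False by simp
  qed
  ultimately show "digraph G \<and> (\<forall>u v. u \<rightarrow>\<^bsub>G\<^esub> v \<longrightarrow> \<not> v \<rightarrow>\<^bsub>G\<^esub> u)" by blast
next
  assume *: "digraph G \<and> (\<forall>u v. u \<rightarrow>\<^bsub>G\<^esub> v \<longrightarrow> \<not> v \<rightarrow>\<^bsub>G\<^esub> u)"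
  then interpret digraph G by blast
  have "inj_on (\<lambda>a. {tail G a, head G a}) (arcs G)"
  proof (rule inj_onI)
    fix a b assume ab: "a \<in> arcs G" "b \<in> arcs G" "{tail G a, head G a} = {tail G b, head G b}"
    then have "tail G a \<rightarrow>\<^bsub>G\<^esub> head G a" "tail G b \<rightarrow>\<^bsub>G\<^esub> head G b"
      by (auto simp: arcs_ends_conv)
    with * have "\<not> (tail G a = head G b \<and> head G a = tail G b)" by metis
    with ab(3) have "arc_to_ends G a = arc_to_ends G b"
      by (simp add: doubleton_eq_iff arc_to_ends_def)
    with ab(1,2) show "a = b" by (rule no_multi_arcs)
  qed
  then have "bij_betw (\<lambda>a. {tail G a, head G a}) (arcs G) ((\<lambda>a. {tail G a, head G a}) ` arcs G)"
    by (simp add: bij_betw_def)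
  moreover have "(\<lambda>a. {tail G a, head G a}) ` arcs G \<subseteq> {e. e \<subseteq> verts G \<and> card e = 2}"
    using no_loops by (auto simp: card_2_iff)
  ultimately show "oriented_graph G"
    unfolding oriented_graph_def by (intro conjI exI) simp_all
qed

text \<open>The arc \<open>es ! i\<close> joins \<open>xs ! i\<close> and \<open>xs ! Suc i\<close> and may be traversed against its direction.\<close>
definition oriented_path :: "('a, 'b) pre_digraph \<Rightarrow> 'a list \<Rightarrow> 'b list \<Rightarrow> bool" where
  "oriented_path G xs es \<longleftrightarrow>
     length xs = Suc (length es) \<and> distinct xs \<and> set xs \<subseteq> verts G \<and> set es \<subseteq> arcs G \<and>
     (\<forall>i < length es. {tail G (es ! i), head G (es ! i)} = {xs ! i, xs ! Suc i})"

text \<open>On an oriented path, \<open>tail G (es ! i) = xs ! i\<close> says that \<open>es ! i\<close> is a forward arc.\<close>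
definition anti_directed_path :: "('a, 'b) pre_digraph \<Rightarrow> 'a list \<Rightarrow> 'b list \<Rightarrow> bool" where
  "anti_directed_path G xs es \<longleftrightarrow> oriented_path G xs es \<and>
     (\<forall>i. Suc i < length es \<longrightarrow>
        (tail G (es ! i) = xs ! i \<longleftrightarrow> tail G (es ! Suc i) \<noteq> xs ! Suc i))"

definition anti_traceable :: "('a, 'b) pre_digraph \<Rightarrow> bool" where
  "anti_traceable G \<longleftrightarrow> (\<exists>xs es. anti_directed_path G xs es \<and> set xs = verts G)"

definition k_anti_traceable :: "nat \<Rightarrow> ('a, 'b) pre_digraph \<Rightarrow> bool" where
  "k_anti_traceable k G \<longleftrightarrow> k \<le> card (verts G) \<and>
     (\<forall>S. S \<subseteq> verts G \<and> card S = k \<longrightarrow> anti_traceable (G \<restriction> S))"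

text \<open>Every oriented graph is finite, hence isomorphic to one with vertices and arcs in \<open>nat\<close>, so
  quantifying over these types loses no generality.\<close>
definition anti_traceability_bound :: "nat \<Rightarrow> nat \<Rightarrow> bool" where
  "anti_traceability_bound k m \<longleftrightarrow> k \<le> m \<and>
     (\<forall>G :: (nat, nat) pre_digraph.
        oriented_graph G \<and> k_anti_traceable k G \<and> m \<le> card (verts G) \<longrightarrow> anti_traceable G)"

definition f :: "nat \<Rightarrow> nat" where
  "f k = (LEAST m. anti_traceability_bound k m)"

end

theory Submission
  imports Defs
begin

text \<open>Extend an anti-directed path vertex by vertex. If the path has \<open>p\<close> vertices, \<open>p \<ge> 4\<close>, and at least
  eight vertices are present, then a path on \<open>p + 1\<close> vertices arises by rearranging only a bounded
  number of vertices: for \<open>p \<in> {4, 5, 6, 8}\<close> all path vertices together with one or two outside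
  vertices; for odd \<open>p \<ge> 7\<close> the first three and the last path vertex together with one outside vertex;
  for even \<open>p \<ge> 10\<close> the first three and the last five together with one outside vertex. In the last two
  cases the middle of the path is kept as it is and only its two ends matter. Each of these is a finite
  statement about at most eleven vertices, proved by a decision tree. The Paley tournament on seven
  vertices shows that eight is optimal.\<close>

section \<open>Signed paths\<close>

text \<open>A vertex of an anti-directed path is paired with \<open>True\<close> if it is the tail of its incident path
  arcs and with \<open>False\<close> if it is the head. Carrying this sign along makes reversal and concatenation of
  paths plain list operations.\<close>
definition link :: "('a \<Rightarrow> 'a \<Rightarrow> bool) \<Rightarrow> 'a \<times> bool \<Rightarrow> 'a \<times> bool \<Rightarrow> bool" where
  "link A p q \<longleftrightarrow> snd p \<noteq> snd q \<and> (if snd p then A (fst p) (fst q) else A (fst q) (fst p))"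

lemma link_sym: "link A p q \<longleftrightarrow> link A q p"
  by (auto simp: link_def)

lemma link_path_rev [simp]: "successively (link A) (rev zs) \<longleftrightarrow> successively (link A) zs"
proof -
  have "(\<lambda>p q. link A q p) = link A"
    by (intro ext link_sym)
  then show ?thesis
    unfolding successively_rev by (rule arg_cong)
qed

fun signed :: "bool \<Rightarrow> 'a list \<Rightarrow> ('a \<times> bool) list" where
  "signed s [] = []"
| "signed s (x # xs) = (x, s) # signed (\<not> s) xs"

lemma map_fst_signed [simp]: "map fst (signed s xs) = xs"
  by (induction xs arbitrary: s) auto

lemma fst_set_signed [simp]: "fst ` set (signed s xs) = set xs"
  by (metis map_fst_signed set_map)

lemma length_signed [simp]: "length (signed s xs) = length xs"
  by (induction xs arbitrary: s) auto

lemma nth_signed: "i < length xs \<Longrightarrow> signed s xs ! i = (xs ! i, s = even i)"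
  by (induction xs arbitrary: s i) (auto simp: nth_Cons split: nat.split)

text \<open>Signs alternate along a linked list, so the first sign and the vertices determine the
  whole list.\<close>

lemma signed_map_fst:
  assumes "successively (link A) zs" "zs \<noteq> []"
  shows "signed (snd (hd zs)) (map fst zs) = zs"
  using assms
proof (induction zs)
  case (Cons z zs)
  then show ?case
    by (cases zs) (auto simp: link_def prod_eq_iff)
qed simp

lemma link_path_sign:
  assumes "successively (link A) zs" "i < length zs"
  shows "snd (zs ! i) \<longleftrightarrow> snd (hd zs) = even i"
proof -
  have "snd (zs ! i) = snd (signed (snd (hd zs)) (map fst zs) ! i)"
    using assms by (subst signed_map_fst) auto
  then show ?thesis
    using assms(2) by (simp add: nth_signed)
qed

text \<open>Reversing every arc exchanges tails and heads, which flips every sign. This later allows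
  the sign of the first path vertex to be prescribed.\<close>

lemma link_path_converse:
  "successively (link A\<inverse>\<inverse>) zs \<longleftrightarrow> successively (link A) (map (map_prod id Not) zs)"
proof -
  have "link A\<inverse>\<inverse> = (\<lambda>p q. link A (map_prod id Not p) (map_prod id Not q))"
    by (auto simp: link_def fun_eq_iff)
  then show ?thesis
    by (simp add: successively_map)
qed

fun path_arcs :: "bool \<Rightarrow> 'a list \<Rightarrow> ('a \<times> 'a) list" where
  "path_arcs s (x # y # xs) = (if s then (x, y) else (y, x)) # path_arcs (\<not> s) (y # xs)"
| "path_arcs s _ = []"

text \<open>Replaces the link condition by a finite list of arcs, which a decision tree can compare
  with the arcs it knows.\<close>

lemma link_path_signed_iff:
  "successively (link A) (signed s xs) \<longleftrightarrow> (\<forall>(u, v)\<in>set (path_arcs s xs). A u v)"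
  by (induction s xs rule: path_arcs.induct) (auto simp: link_def)

lemma path_arcs_map: "path_arcs s (map g xs) = map (map_prod g g) (path_arcs s xs)"
  by (induction s xs rule: path_arcs.induct) auto

definition has_path :: "('a \<Rightarrow> 'a \<Rightarrow> bool) \<Rightarrow> 'a set \<Rightarrow> nat \<Rightarrow> bool" where
  "has_path A V m \<longleftrightarrow> (\<exists>zs. successively (link A) zs \<and> distinct (map fst zs) \<and>
     fst ` set zs \<subseteq> V \<and> length zs = m)"

lemma has_path_converse: "has_path A\<inverse>\<inverse> V m \<Longrightarrow> has_path A V m"
  unfolding has_path_def link_path_converse
  by (elim exE, rule_tac x = "map (map_prod id Not) zs" in exI) (auto simp: image_image comp_def)

section \<open>Decision trees\<close>

text \<open>\<open>Path\<close> lists the vertices of two signed paths all of whose arcs are known to be present (they are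
  attached to the two ends of the middle part, or the first one is empty), \<open>Quad\<close> names four vertices
  that cannot be traced without an arc known to be absent, and \<open>Split\<close> branches on an arc.\<close>
datatype cert =
    Path bool "nat list" bool "nat list"
  | Quad nat nat nat nat
  | Split nat nat cert cert

text \<open>Exactly one end of an anti-directed path on four vertices is a tail, so reading from
  that end gives the single shape \<open>w -> x <- y -> z\<close>. The vertices are chosen in the
  order \<open>x\<close>, \<open>w\<close>, \<open>y\<close>, \<open>z\<close>, and each arc is
  tested as soon as both its ends are fixed, which prunes the search early.\<close>

definition quad_blocked :: "(nat \<times> nat) list \<Rightarrow> nat list \<Rightarrow> bool" where
  "quad_blocked N Q \<longleftrightarrow>
     (\<forall>x\<in>set Q. \<forall>w\<in>set (removeAll x Q). (w, x) \<in> set N \<or>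
       (\<forall>y\<in>set (removeAll w (removeAll x Q)). (y, x) \<in> set N \<or>
         (\<forall>z\<in>set (removeAll y (removeAll w (removeAll x Q))). (y, z) \<in> set N)))"

text \<open>\<open>P\<close> and \<open>N\<close> collect the arcs known to be present and absent.
  An arc excludes its reverse, so the first branch of \<open>Split\<close> extends both lists. In
  the second branch the reverse arc stays undecided, as the two vertices may be non-adjacent. The
  parameter \<open>goal\<close> lets whole paths and windows share one checker.\<close>

fun cert_ok :: "nat \<Rightarrow> (bool \<Rightarrow> nat list \<Rightarrow> bool \<Rightarrow> nat list \<Rightarrow> bool) \<Rightarrow>
    (nat \<times> nat) list \<Rightarrow> (nat \<times> nat) list \<Rightarrow> cert \<Rightarrow> bool" where
  "cert_ok n goal P N (Path s L t R) \<longleftrightarrow>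
     goal s L t R \<and> (\<forall>e\<in>set (path_arcs s L @ path_arcs t R). e \<in> set P)"
| "cert_ok n goal P N (Quad a b c d) \<longleftrightarrow>
     distinct [a, b, c, d] \<and> (\<forall>x\<in>set [a, b, c, d]. x < n) \<and> quad_blocked N [a, b, c, d]"
| "cert_ok n goal P N (Split u v yes no) \<longleftrightarrow>
     cert_ok n goal ((u, v) # P) ((v, u) # N) yes \<and> cert_ok n goal P ((u, v) # N) no"

text \<open>The single path is stored in the second list. If two outside vertices are present, one
  of the \<open>n\<close> vertices is left over.\<close>

definition goal_path :: "nat \<Rightarrow> nat \<Rightarrow> bool \<Rightarrow> nat list \<Rightarrow> bool \<Rightarrow> nat list \<Rightarrow> bool" where
  "goal_path n m s L t R \<longleftrightarrow> L = [] \<and> distinct R \<and> length R = m \<and> (\<forall>x\<in>set R. x < n)"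

text \<open>The two lists together use up all \<open>n\<close> vertices but may divide them in any
  way, so vertices can move from one end of the path to the other. Both lists start at an end of the
  middle part, with the sign that this end has on the old path.\<close>

definition goal_window :: "nat \<Rightarrow> nat \<Rightarrow> bool \<Rightarrow> bool \<Rightarrow> nat list \<Rightarrow> bool \<Rightarrow> nat list \<Rightarrow> bool" where
  "goal_window n j r s L t R \<longleftrightarrow> s \<and> t = r \<and> L \<noteq> [] \<and> R \<noteq> [] \<and> hd L = j \<and> hd R = Suc j \<and>
     distinct (L @ R) \<and> length (L @ R) = n \<and> (\<forall>x\<in>set (L @ R). x < n)"

text \<open>Vertex \<open>i < p\<close> is the \<open>i\<close>-th vertex of the given path, which starts at a tail; the others lie outside
  the path.\<close>
definition path_cert :: "nat \<Rightarrow> nat \<Rightarrow> cert \<Rightarrow> bool" where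
  "path_cert n p t \<longleftrightarrow>
     (let P = path_arcs True [0..<p] in cert_ok n (goal_path n (Suc p)) P (map prod.swap P) t)"

text \<open>Vertices \<open>0, \<dots>, j - 1\<close> are the first \<open>j\<close> vertices of the path, \<open>j\<close> and \<open>j + 1\<close> the ends of the
  untouched middle part, \<open>j + 2, \<dots>, j + k + 1\<close> the last \<open>k\<close> vertices, and \<open>j + k + 2\<close> lies outside. Vertex
  \<open>j\<close> is a tail on the path and \<open>r\<close> is the sign of \<open>j + 1\<close>.\<close>
definition window_cert :: "nat \<Rightarrow> nat \<Rightarrow> bool \<Rightarrow> cert \<Rightarrow> bool" where
  "window_cert j k r t \<longleftrightarrow>
     (let n = j + k + 3; P = path_arcs True (rev [0..<Suc j]) @ path_arcs r [Suc j..<n - 1]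
      in cert_ok n (goal_window n j r) P (map prod.swap P) t)"

section \<open>Soundness of the decision trees\<close>

locale quad_traceable =
  fixes A :: "'a \<Rightarrow> 'a \<Rightarrow> bool" and V :: "'a set"
  assumes finite_V: "finite V"
    and asym: "A u v \<Longrightarrow> \<not> A v u"
    and quad: "Q \<subseteq> V \<Longrightarrow> card Q = 4 \<Longrightarrow> \<exists>w x y z. Q = {w, x, y, z} \<and> A w x \<and> A y x \<and> A y z"
begin

text \<open>Read backwards, the converse of \<open>w -> x <- y -> z\<close> has the same shape
  again, so the hypotheses survive the reversal of all arcs.\<close>

lemma quad_traceable_converse: "quad_traceable A\<inverse>\<inverse> V"
proof
  fix Q assume "Q \<subseteq> V" "card Q = 4"
  from quad[OF this] obtain w x y z where "Q = {w, x, y, z}" "A w x" "A y x" "A y z"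
    by blast
  then have "Q = {z, y, x, w} \<and> A\<inverse>\<inverse> z y \<and> A\<inverse>\<inverse> x y \<and> A\<inverse>\<inverse> x w"
    by auto
  then show "\<exists>w x y z. Q = {w, x, y, z} \<and> A\<inverse>\<inverse> w x \<and> A\<inverse>\<inverse> y x \<and> A\<inverse>\<inverse> y z"
    by blast
qed (auto simp: finite_V dest: asym)

lemma quad_blocked_false:
  assumes g: "inj_on g {..<n}" "g ` {..<n} \<subseteq> V"
    and Q: "distinct Q" "length Q = 4" "\<forall>x\<in>set Q. x < n"
    and N: "\<forall>(u, v)\<in>set N. \<not> A (g u) (g v)"
  shows "\<not> quad_blocked N Q"
proof
  assume blocked: "quad_blocked N Q"
  have "inj_on g (set Q)"
    using g(1) Q(3) by (auto intro: inj_on_subset)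
  then have card: "card (g ` set Q) = 4"
    using Q(1,2) by (simp add: card_image distinct_card)
  moreover have "g ` set Q \<subseteq> V"
    using g(2) Q(3) by auto
  ultimately obtain w x y z where eq: "g ` set Q = {w, x, y, z}" and A: "A w x" "A y x" "A y z"
    using quad by metis
  have "w \<in> g ` set Q" "x \<in> g ` set Q" "y \<in> g ` set Q" "z \<in> g ` set Q"
    unfolding eq by auto
  then obtain w' x' y' z' where in_Q: "w' \<in> set Q" "x' \<in> set Q" "y' \<in> set Q" "z' \<in> set Q"
    and g': "g w' = w" "g x' = x" "g y' = y" "g z' = z"
    by (elim imageE) blast
  have "distinct [w, x, y, z]"
    using card unfolding eq by (intro card_distinct) simp
  then have "distinct [w', x', y', z']"
    using g' by auto
  then have "(w', x') \<in> set N \<or> (y', x') \<in> set N \<or> (y', z') \<in> set N"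
    using blocked in_Q unfolding quad_blocked_def by (auto 4 4)
  then show False
    using N A g' by auto
qed

text \<open>Follow the branches that are true in the graph. The leaf reached cannot be a
  \<open>Quad\<close>, since its four vertices would have no anti-directed path; hence it is a
  \<open>Path\<close> whose arcs are all present.\<close>

lemma cert_sound:
  assumes g: "inj_on g {..<n}" "g ` {..<n} \<subseteq> V"
    and "cert_ok n goal P N c"
    and "\<forall>(u, v)\<in>set P. A (g u) (g v)" "\<forall>(u, v)\<in>set N. \<not> A (g u) (g v)"
  shows "\<exists>s L t R. goal s L t R \<and> successively (link A) (signed s (map g L)) \<and>
    successively (link A) (signed t (map g R))"
  using assms(3-)
proof (induction c arbitrary: P N)
  case (Path s L t R)
  have "\<forall>(u, v)\<in>set (path_arcs s L) \<union> set (path_arcs t R). A (g u) (g v)"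
    using Path by fastforce
  then have "successively (link A) (signed s (map g L))" "successively (link A) (signed t (map g R))"
    unfolding link_path_signed_iff path_arcs_map by (simp_all add: ball_Un case_prod_beta)
  moreover have "goal s L t R"
    using Path.prems(1) by simp
  ultimately show ?case by blast
next
  case (Quad a b c d)
  then show ?case
    using quad_blocked_false[OF g, of "[a, b, c, d]" N] by auto
next
  case (Split u v yes no)
  show ?case
  proof (cases "A (g u) (g v)")
    case True
    with asym have "\<not> A (g v) (g u)" by blast
    with True Split show ?thesis
      by (intro Split.IH(1)[of "(u, v) # P" "(v, u) # N"]) auto
  next
    case False
    with Split show ?thesis
      by (intro Split.IH(2)[of P "(u, v) # N"]) auto
  qed
qed

lemma cert_sound_initial:
  assumes "inj_on g {..<n}" "g ` {..<n} \<subseteq> V"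
    and "cert_ok n goal P (map prod.swap P) c" "\<forall>(u, v)\<in>set P. A (g u) (g v)"
  shows "\<exists>s L t R. goal s L t R \<and> successively (link A) (signed s (map g L)) \<and>
    successively (link A) (signed t (map g R))"
proof (rule cert_sound[OF assms])
  show "\<forall>(u, v)\<in>set (map prod.swap P). \<not> A (g u) (g v)"
    using assms(4) by (auto dest: asym)
qed

lemma path_cert_extends:
  assumes cert: "path_cert n p c"
    and zs: "successively (link A) zs" "distinct (map fst zs)" "fst ` set zs \<subseteq> V" "length zs = p"
    and bounds: "0 < p" "p \<le> n" "n \<le> card V"
    and source: "snd (hd zs)"
  shows "has_path A V (Suc p)"
proof -
  have "card (V - fst ` set zs) = card V - p"
    using zs finite_V by (simp add: card_Diff_subset distinct_card flip: set_map)
  then have "n - p \<le> card (V - fst ` set zs)"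
    using bounds by simp
  then obtain Y where Y: "Y \<subseteq> V - fst ` set zs" "card Y = n - p" "finite Y"
    by (rule obtain_subset_with_card_n)
  then obtain ys where ys: "set ys = Y" "distinct ys" "length ys = n - p"
    by (metis finite_distinct_list distinct_card)
  \<comment> \<open>Label \<open>i\<close> stands for the \<open>i\<close>-th path vertex if
    \<open>i < p\<close> and for a chosen outside vertex otherwise.\<close>
  define vs where "vs = map fst zs @ ys"
  define g where "g = (!) vs"
  have vs: "distinct vs" "length vs = n" "set vs \<subseteq> V"
    using zs ys Y bounds by (auto simp: vs_def)
  have g: "inj_on g {..<n}" "g ` {..<n} \<subseteq> V"
    using vs by (auto simp: g_def inj_on_def nth_eq_iff_index_eq)
  have "map g [0..<p] = map fst zs"
    using zs(4) bounds by (intro nth_equalityI) (auto simp: g_def vs_def nth_append)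
  then have "signed True (map g [0..<p]) = zs"
    using signed_map_fst[OF zs(1)] source zs(4) bounds by auto
  then have "\<forall>(u, v)\<in>set (path_arcs True [0..<p]). A (g u) (g v)"
    using zs(1) link_path_signed_iff[of A True "map g [0..<p]"] by (auto simp: path_arcs_map)
  then obtain t R where R: "distinct R" "length R = Suc p" "\<forall>x\<in>set R. x < n"
      "successively (link A) (signed t (map g R))"
    using cert_sound_initial[OF g, of _ "path_arcs True [0..<p]" c] cert
    unfolding path_cert_def Let_def goal_path_def by blast
  have "distinct (map g R)"
    using R g(1) by (auto simp: distinct_map intro: inj_on_subset)
  moreover have "fst ` set (signed t (map g R)) \<subseteq> V"
    using R(3) g(2) by auto
  ultimately show ?thesis
    using R unfolding has_path_def by (intro exI[of _ "signed t (map g R)"]) auto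
qed

text \<open>The new path is the first list reversed, then the old middle part, then the second list,
  where each list shares exactly its first vertex with the middle. These shared vertices keep their
  signs, so the pieces fit together and the inside of the middle is unaffected.\<close>

lemma window_cert_extends:
  assumes cert: "window_cert j k r c"
    and zs: "successively (link A) zs" "distinct (map fst zs)" "fst ` set zs \<subseteq> V" "length zs = p"
    and p: "j + k + 2 \<le> p" and v: "v \<in> V - fst ` set zs"
    and sign: "snd (zs ! j)" "snd (zs ! (p - Suc k)) = r"
  shows "has_path A V (Suc p)"
proof -
  define n where "n = j + k + 3"
  define zl where "zl = take j zs"
  define mid where "mid = take (p - j - k) (drop j zs)"
  define zr where "zr = drop (p - k) zs"
  have len: "length zl = j" "length mid = p - j - k" "length zr = k"
    using zs(4) p by (auto simp: zl_def mid_def zr_def)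
  have "zr = drop (p - j - k) (drop j zs)"
    using p by (simp add: zr_def)
  then have split: "zs = zl @ mid @ zr"
    unfolding zl_def mid_def by (metis append_take_drop_id)
  define za where "za = hd mid"
  define zb where "zb = last mid"
  have "mid \<noteq> []"
    using len(2) p by auto
  then have mid: "mid \<noteq> []" "za \<in> set mid" "zb \<in> set mid"
    by (auto simp: za_def zb_def)
  have mid_nth: "zs ! (j + i) = mid ! i" if "i < length mid" for i
    using that by (simp add: split nth_append flip: len(1))
  have za: "za = zs ! j"
    using mid_nth[of 0] mid(1) by (simp add: za_def hd_conv_nth)
  have "p - Suc k = j + (length mid - 1)" "length mid - 1 < length mid"
    using p len by auto
  then have zb: "zb = zs ! (p - Suc k)"
    using mid_nth[of "length mid - 1"] mid(1) by (metis zb_def last_conv_nth)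
  \<comment> \<open>The middle part has \<open>p - j - k\<close> vertices, hence at least two, and
    its ends differ.\<close>
  have zab: "fst za \<noteq> fst zb"
    using nth_eq_iff_index_eq[OF zs(2), of j "p - Suc k"] zs(4) p by (simp add: za zb)
  \<comment> \<open>Of the middle part only the two ends receive labels, namely \<open>j\<close> and
    \<open>Suc j\<close>; the outside vertex has the last label.\<close>
  define vs where "vs = map fst (zl @ [za, zb] @ zr) @ [v]"
  define g where "g = (!) vs"
  have "distinct (map fst (zl @ mid @ zr))" "v \<notin> fst ` set (zl @ mid @ zr)"
    using zs(2) v unfolding split by auto
  then have vs: "distinct vs" "length vs = n" "set vs \<subseteq> V"
    using mid zab len zs(3) v unfolding vs_def n_def split by auto
  have g: "inj_on g {..<n}" "g ` {..<n} \<subseteq> V"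
    using vs by (auto simp: g_def inj_on_def nth_eq_iff_index_eq)
  have g_ab: "g j = fst za" "g (Suc j) = fst zb"
    by (auto simp: g_def vs_def nth_append len)
  have path: "successively (link A) (zl @ mid @ zr)"
    using zs(1) split by simp
  have succ_l: "successively (link A) (rev (zl @ [za]))"
    using path mid(1) unfolding za_def link_path_rev by (auto simp: successively_append_iff)
  have succ_r: "successively (link A) (zb # zr)"
    using path mid(1) unfolding zb_def
    by (auto simp: successively_append_iff successively_Cons)
  have map_l: "map g (rev [0..<Suc j]) = map fst (rev (zl @ [za]))"
    unfolding rev_map[symmetric]
    by (intro arg_cong[of _ _ rev] nth_equalityI) (auto simp: g_def vs_def nth_append len less_Suc_eq)
  have map_r: "map g [Suc j..<n - 1] = map fst (zb # zr)"
    by (intro nth_equalityI)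
       (auto simp: g_def vs_def n_def nth_append len nth_Cons' simp del: upt_Suc)
  \<comment> \<open>The initial segment is read from label \<open>j\<close> back to label
    \<open>0\<close>, so that it starts at the end of the middle part, a tail.\<close>
  define P where "P = path_arcs True (rev [0..<Suc j]) @ path_arcs r [Suc j..<n - 1]"
  have "signed True (map g (rev [0..<Suc j])) = rev (zl @ [za])"
    unfolding map_l using signed_map_fst[OF succ_l] sign(1) by (simp add: za)
  moreover have "signed r (map g [Suc j..<n - 1]) = zb # zr"
    unfolding map_r using signed_map_fst[OF succ_r] sign(2) by (simp add: zb)
  ultimately have known: "\<forall>(u, v)\<in>set P. A (g u) (g v)"
    using succ_l succ_r link_path_signed_iff[of A True "map g (rev [0..<Suc j])"]
      link_path_signed_iff[of A r "map g [Suc j..<n - 1]"]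
    by (auto simp: P_def path_arcs_map simp del: upt_Suc)
  have "cert_ok n (goal_window n j r) P (map prod.swap P) c"
    using cert unfolding window_cert_def Let_def P_def n_def .
  from cert_sound_initial[OF g this known] obtain L R where
    LR: "L \<noteq> []" "R \<noteq> []" "hd L = j" "hd R = Suc j" "distinct (L @ R)"
      "length (L @ R) = n" "\<forall>x\<in>set (L @ R). x < n"
      "successively (link A) (signed True (map g L))" "successively (link A) (signed r (map g R))"
    unfolding goal_window_def by auto
  obtain L' R' where L': "L = j # L'" and R': "R = Suc j # R'"
    using LR(1-4) by (metis list.collapse)
  \<comment> \<open>The first entries of \<open>L\<close> and \<open>R\<close> already belong to the
    middle part, so only the remainders are attached, beginning with the opposite signs.\<close>
  define l where "l = signed False (map g L')"
  define q where "q = signed (\<not> r) (map g R')"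
  have za': "za = (fst za, True)" and zb': "zb = (fst zb, r)"
    using sign by (auto simp: za zb prod_eq_iff)
  have "successively (link A) (za # l)" "successively (link A) (zb # q)"
    using LR(8,9) za' zb' by (auto simp: L' R' l_def q_def g_ab)
  then have new: "successively (link A) (rev l @ mid @ q)"
    using path mid(1) unfolding za_def zb_def
    by (auto simp: successively_append_iff successively_Cons last_rev link_sym)
  have fst_lq: "map fst (rev l @ mid @ q) = rev (map g L') @ map fst mid @ map g R'"
    by (simp add: l_def q_def rev_map[symmetric])
  have sub: "set L' \<union> set R' \<subseteq> {..<n} - {j, Suc j}"
    using LR(5,7) by (auto simp: L' R')
  have "inj_on g (set (L' @ R'))"
    using g(1) sub by (auto intro: inj_on_subset)
  then have distinct_new: "distinct (map g (L' @ R'))"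
    using LR(5) unfolding L' R' distinct_map by auto
  \<comment> \<open>The only labelled vertices in the middle part are its ends, and their labels do
    not occur in \<open>L'\<close> and \<open>R'\<close>.\<close>
  have avoid: "g x \<notin> fst ` set mid" if "x \<in> set L' \<union> set R'" for x
  proof -
    have x: "x < n" "x \<noteq> j" "x \<noteq> Suc j"
      using that sub by auto
    moreover have "j < n" "Suc j < n"
      by (auto simp: n_def)
    ultimately have "g x \<noteq> fst za" "g x \<noteq> fst zb"
      using g(1) unfolding g_ab[symmetric] by (auto simp: inj_on_def)
    moreover have "g x \<in> set vs"
      using x vs(2) by (simp add: g_def)
    ultimately have "g x \<in> fst ` set zl \<union> fst ` set zr \<union> {v}"
      by (auto simp: vs_def)
    then show ?thesis
      using zs(2) v unfolding split by auto
  qed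
  have "g ` (set L' \<union> set R') \<inter> fst ` set mid = {}"
    using avoid by blast
  moreover note distinct_new
  moreover have "distinct (map fst mid)"
    using zs(2) unfolding split by simp
  ultimately have "distinct (map fst (rev l @ mid @ q))"
    unfolding fst_lq by (simp add: image_Un Int_Un_distrib Int_Un_distrib2 Int_commute)
  moreover have "fst ` set (rev l @ mid @ q) \<subseteq> V"
  proof -
    have "fst ` set (rev l @ mid @ q) = g ` (set L' \<union> set R') \<union> fst ` set mid"
      unfolding set_map[symmetric] fst_lq by auto
    moreover have "fst ` set mid \<subseteq> V"
      using zs(3) unfolding split by auto
    moreover have "g ` (set L' \<union> set R') \<subseteq> V"
      using sub g(2) by blast
    ultimately show ?thesis
      by simp
  qed
  \<comment> \<open>The attached pieces have \<open>n - 2 = j + k + 1\<close> vertices and the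
    middle part has \<open>p - j - k\<close>, which makes \<open>p + 1\<close>.\<close>
  moreover have "length (rev l @ mid @ q) = Suc p"
    using LR(6) len p by (simp add: l_def q_def L' R' n_def)
  ultimately show ?thesis
    using new unfolding has_path_def by blast
qed

end

section \<open>The six decision trees\<close>

definition cert_4 :: cert where
  "cert_4 =
    Split 0 4 (Path True [] False [3,2,1,0,4]) (Split 0 5 (Path True [] False [3,2,1,0,5])
    (Split 4 3 (Path True [] True [0,1,2,3,4]) (Split 5 3 (Path True [] True [0,1,2,3,5]) (Split
    2 4 (Split 3 4 (Path True [] True [0,1,2,4,3]) (Split 5 4 (Path True [] True [0,1,2,4,5])
    (Split 2 5 (Split 3 5 (Path True [] True [3,5,2,1,0]) (Split 4 5 (Path True [] True
    [0,1,2,5,4]) (Quad 0 3 4 5))) (Quad 2 3 4 5)))) (Split 4 5 (Split 2 5 (Path True [] True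
    [4,5,2,1,0]) (Split 4 1 (Path True [] False [5,4,1,2,3]) (Split 4 0 (Split 4 2 (Split 0 2
    (Path True [] False [1,0,2,4,5]) (Split 2 0 (Path True [] False [5,4,0,2,3]) (Quad 0 1 2
    4))) (Quad 1 2 4 5)) (Quad 0 1 4 5)))) (Split 5 2 (Split 5 4 (Split 0 2 (Path True [] False
    [4,5,2,0,1]) (Split 5 1 (Path True [] False [4,5,1,2,3]) (Split 2 0 (Split 5 0 (Path True []
    False [1,2,0,5,4]) (Quad 0 1 2 5)) (Quad 0 1 2 5)))) (Quad 2 3 4 5)) (Split 3 5 (Split 2 5
    (Path True [] True [0,1,2,5,3]) (Quad 2 3 4 5)) (Quad 2 3 4 5))))))))"

definition cert_5 :: cert where
  "cert_5 =
    Split 0 5 (Path True [] True [4,3,2,1,0,5]) (Split 4 5 (Path True [] False [5,4,3,2,1,0])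
    (Split 4 0 (Split 5 0 (Path True [] False [1,2,3,4,0,5]) (Split 5 1 (Path True [] False
    [0,4,3,2,1,5]) (Quad 0 1 4 5))) (Split 5 3 (Split 0 4 (Path True [] False [4,0,1,2,3,5])
    (Split 5 4 (Path True [] True [0,1,2,3,5,4]) (Split 5 1 (Split 5 0 (Path True [] True
    [4,3,2,1,5,0]) (Quad 0 1 4 5)) (Quad 0 1 4 5)))) (Split 5 4 (Split 0 4 (Path True [] False
    [3,2,1,0,4,5]) (Split 3 0 (Split 5 0 (Split 4 1 (Split 5 1 (Path True [] True [4,3,2,1,5,0])
    (Quad 0 1 4 5)) (Quad 0 1 3 4)) (Quad 0 3 4 5)) (Quad 0 3 4 5))) (Quad 0 3 4 5)))))"

text \<open>Labels \<open>6\<close> and \<open>7\<close> lie outside the path. A single outside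
  vertex would not suffice: the Paley tournament below has an anti-directed path on six vertices,
  but none on all seven.\<close>

definition cert_6 :: cert where
  "cert_6 =
    Split 0 6 (Path True [] False [5,4,3,2,1,0,6]) (Split 0 7 (Path True [] False
    [7,0,1,2,3,4,5]) (Split 6 5 (Path True [] True [6,5,4,3,2,1,0]) (Split 7 5 (Path True []
    True [7,5,4,3,2,1,0]) (Split 6 1 (Split 6 0 (Path True [] False [0,6,1,2,3,4,5]) (Split 6 7
    (Path True [] False [7,6,1,2,3,4,5]) (Split 7 1 (Split 7 0 (Path True [] False
    [5,4,3,2,1,7,0]) (Split 7 6 (Path True [] False [5,4,3,2,1,7,6]) (Quad 0 1 6 7))) (Quad 0 1
    6 7)))) (Split 7 6 (Split 4 6 (Path True [] True [0,1,2,3,4,6,7]) (Split 7 1 (Path True []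
    False [5,4,3,2,1,7,6]) (Split 1 6 (Split 5 6 (Split 1 5 (Path True [] True [7,6,1,5,4,3,2])
    (Split 5 1 (Path True [] True [4,3,2,1,5,6,7]) (Split 5 0 (Split 1 4 (Quad 0 1 4 5) (Quad 1
    4 5 6)) (Quad 0 1 5 6)))) (Quad 4 5 6 7)) (Quad 0 1 6 7)))) (Split 7 1 (Split 7 0 (Path True
    [] False [0,7,1,2,3,4,5]) (Quad 0 1 6 7)) (Split 6 7 (Split 1 7 (Split 1 5 (Path True []
    True [2,3,4,5,1,7,6]) (Split 4 7 (Path True [] True [6,7,4,3,2,1,0]) (Split 5 7 (Split 5 1
    (Path True [] True [6,7,5,1,2,3,4]) (Split 5 0 (Split 1 4 (Quad 0 1 4 5) (Quad 1 4 5 7))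
    (Quad 0 1 5 6))) (Quad 1 4 5 7)))) (Quad 0 1 6 7)) (Quad 0 1 6 7))))))))"

definition cert_8 :: cert where
  "cert_8 =
    Split 0 8 (Path True [] False [8,0,1,2,3,4,5,6,7]) (Split 8 7 (Path True [] True
    [8,7,6,5,4,3,2,1,0]) (Split 0 7 (Split 2 8 (Path True [] False [1,0,7,6,5,4,3,2,8]) (Split 4
    8 (Path True [] False [5,6,7,0,1,2,3,4,8]) (Split 6 8 (Path True [] False
    [7,0,1,2,3,4,5,6,8]) (Split 8 1 (Path True [] True [2,3,4,5,6,7,0,1,8]) (Split 8 3 (Path
    True [] True [4,5,6,7,0,1,2,3,8]) (Split 8 5 (Path True [] True [8,5,6,7,0,1,2,3,4]) (Split
    5 3 (Split 5 8 (Split 6 4 (Path True [] False [4,6,7,0,1,2,3,5,8]) (Split 8 6 (Split 4 6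
    (Split 2 6 (Path True [] False [7,0,1,2,6,4,3,5,8]) (Split 4 7 (Path True [] False
    [6,4,7,0,1,2,3,5,8]) (Split 5 7 (Path True [] False [6,4,3,2,1,0,7,5,8]) (Split 7 8 (Split 8
    2 (Split 7 4 (Split 8 4 (Split 7 5 (Split 0 5 (Path True [] True [7,5,0,1,2,3,4,6,8]) (Split
    0 6 (Path True [] True [2,1,0,6,4,3,5,8,7]) (Split 5 1 (Path True [] False
    [2,8,6,4,3,5,1,0,7]) (Split 6 3 (Path True [] True [0,1,2,3,6,5,7,4,8]) (Split 7 3 (Path
    True [] True [8,6,4,5,7,3,2,1,0]) (Split 1 8 (Split 5 0 (Split 6 0 (Split 3 6 (Split 3 7
    (Split 2 4 (Path True [] True [6,0,5,3,2,4,7,8,1]) (Split 2 5 (Path True [] True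
    [3,7,0,1,2,5,4,6,8]) (Split 4 1 (Path True [] False [5,4,1,0,7,3,6,8,2]) (Split 4 2 (Path
    True [] False [1,0,7,3,6,8,2,4,5]) (Quad 1 2 4 5))))) (Quad 3 4 6 7)) (Quad 2 3 6 8)) (Quad
    0 6 7 8)) (Quad 0 1 5 8)) (Quad 0 1 5 8))))))) (Quad 5 6 7 8)) (Quad 4 6 7 8)) (Quad 4 6 7
    8)) (Quad 1 2 6 8)) (Quad 0 5 7 8))))) (Quad 4 5 6 8)) (Quad 4 5 6 8))) (Quad 3 4 5 8))
    (Split 3 8 (Split 3 5 (Split 2 4 (Path True [] False [4,2,1,0,7,6,5,3,8]) (Split 8 2 (Split
    4 2 (Split 3 1 (Path True [] False [2,4,5,6,7,0,1,3,8]) (Split 4 1 (Path True [] False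
    [8,3,5,6,7,0,1,4,2]) (Split 6 2 (Path True [] False [8,3,5,4,2,6,7,0,1]) (Split 1 8 (Split 1
    3 (Split 8 4 (Split 1 4 (Split 8 6 (Split 0 2 (Path True [] True [1,3,4,5,6,7,0,2,8]) (Split
    0 3 (Path True [] True [1,3,0,7,6,5,4,2,8]) (Split 1 5 (Path True [] True
    [0,7,6,5,1,3,4,2,8]) (Split 2 5 (Path True [] True [0,7,6,5,2,3,1,4,8]) (Split 3 7 (Path
    True [] False [6,8,2,4,5,3,7,0,1]) (Split 2 0 (Split 3 0 (Split 7 8 (Split 5 1 (Split 5 2
    (Split 4 6 (Path True [] False [3,4,6,8,2,5,1,0,7]) (Split 6 1 (Path True [] True
    [7,8,3,0,2,1,6,5,4]) (Split 6 4 (Path True [] True [2,0,3,5,6,4,1,8,7]) (Quad 1 4 5 6))))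
    (Quad 1 2 4 5)) (Quad 1 2 3 5)) (Quad 0 3 7 8)) (Quad 0 1 3 8)) (Quad 0 1 2 8))))))) (Quad 2
    5 6 8)) (Quad 1 2 4 8)) (Quad 1 2 4 8)) (Quad 1 2 3 8)) (Quad 0 1 3 8))))) (Quad 2 3 4 8))
    (Quad 1 2 4 8))) (Quad 3 4 5 8)) (Quad 2 3 5 8))))))))) (Split 7 0 (Split 6 0 (Split 7 8
    (Path True [] False [8,7,0,6,5,4,3,2,1]) (Split 8 1 (Path True [] True [7,0,6,5,4,3,2,1,8])
    (Split 7 1 (Split 8 0 (Path True [] True [6,5,4,3,2,1,7,0,8]) (Quad 0 1 7 8)) (Quad 0 1 7
    8)))) (Split 8 6 (Split 8 0 (Split 7 1 (Path True [] True [8,0,7,1,2,3,4,5,6]) (Split 7 5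
    (Path True [] False [1,2,3,4,5,7,0,8,6]) (Split 8 1 (Path True [] False [7,6,5,4,3,2,1,8,0])
    (Split 7 8 (Split 1 8 (Split 2 0 (Path True [] True [1,8,7,0,2,3,4,5,6]) (Split 1 6 (Split 0
    6 (Split 1 7 (Split 0 5 (Path True [] True [7,8,1,6,0,5,4,3,2]) (Split 1 5 (Path True []
    True [7,0,8,6,1,5,4,3,2]) (Split 2 6 (Path True [] False [5,4,3,2,6,1,8,7,0]) (Split 2 7
    (Path True [] False [0,8,6,1,7,2,3,4,5]) (Split 0 2 (Split 5 1 (Split 5 7 (Split 6 2 (Split
    0 3 (Path True [] False [2,0,3,4,5,6,7,1,8]) (Split 1 3 (Path True [] False
    [2,6,5,4,3,1,8,7,0]) (Split 4 0 (Path True [] True [8,0,4,3,2,1,5,7,6]) (Split 4 6 (Path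
    True [] True [5,1,2,3,4,6,8,0,7]) (Split 4 7 (Path True [] True [8,6,0,1,2,3,4,7,5]) (Split
    7 3 (Path True [] False [1,0,2,6,5,4,3,7,8]) (Split 3 0 (Split 7 4 (Split 6 4 (Split 3 1
    (Split 2 8 (Path True [] False [5,6,4,7,0,3,1,2,8]) (Split 8 2 (Path True [] False
    [2,8,0,3,1,5,7,6,4]) (Quad 0 1 2 8))) (Quad 1 2 3 7)) (Quad 0 4 5 6)) (Quad 0 3 4 7)) (Quad
    0 2 3 7)))))))) (Quad 1 2 6 7)) (Quad 0 5 6 7)) (Quad 0 1 5 6)) (Quad 0 1 2 7)))))) (Quad 0
    1 6 7)) (Quad 0 1 6 7)) (Split 6 1 (Split 0 6 (Split 1 7 (Split 2 8 (Path True [] True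
    [7,8,2,3,4,5,6,1,0]) (Split 4 0 (Path True [] False [3,2,1,6,5,4,0,7,8]) (Split 8 5 (Path
    True [] False [7,6,1,2,3,4,5,8,0]) (Split 0 2 (Split 5 7 (Split 5 0 (Path True [] True
    [8,0,5,7,6,1,2,3,4]) (Split 7 2 (Path True [] False [3,4,5,6,1,0,2,7,8]) (Split 2 7 (Split 0
    5 (Path True [] False [8,1,7,2,3,4,5,0,6]) (Quad 0 4 5 7)) (Quad 0 1 2 7)))) (Quad 5 6 7 8))
    (Quad 0 1 2 8))))) (Quad 1 6 7 8)) (Quad 0 1 6 8)) (Quad 0 1 6 7)))) (Quad 0 1 7 8)) (Quad 0
    1 7 8))))) (Quad 0 6 7 8)) (Split 7 8 (Split 6 8 (Path True [] True [7,8,6,5,4,3,2,1,0])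
    (Quad 0 6 7 8)) (Quad 0 6 7 8)))) (Split 7 1 (Split 6 0 (Split 7 8 (Path True [] False
    [0,6,5,4,3,2,1,7,8]) (Split 8 0 (Path True [] True [7,1,2,3,4,5,6,0,8]) (Quad 0 1 7 8)))
    (Quad 0 6 7 8)) (Quad 0 1 7 8)))))"

text \<open>Labels \<open>0\<close>, \<open>1\<close>, \<open>2\<close> are the first three path
  vertices, \<open>3\<close> and \<open>4\<close> the ends of the middle part, \<open>5\<close> the
  last path vertex and \<open>6\<close> the outside vertex.\<close>

definition cert_odd :: cert where
  "cert_odd =
    Split 6 0 (Path True [3,2,1,0,6] True [4,5]) (Split 6 5 (Path True [3,2,1,0] True [4,5,6])
    (Split 5 0 (Split 4 6 (Path True [3,2,1,0,5] True [4,6]) (Split 5 6 (Path True [3,2,1,0,5,6]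
    True [4]) (Quad 0 4 5 6))) (Split 0 6 (Split 0 5 (Path True [3,2,1] True [4,5,0,6]) (Split 1
    6 (Path True [3,2,1,6,0] True [4,5]) (Split 5 1 (Split 5 6 (Split 4 0 (Split 4 6 (Path True
    [3,2,1,0] True [4,6,5]) (Quad 0 4 5 6)) (Quad 0 1 4 5)) (Quad 0 1 5 6)) (Quad 0 1 5 6))))
    (Split 1 6 (Split 0 5 (Path True [3,2,1,6] True [4,5,0]) (Split 5 6 (Split 4 6 (Path True
    [3,2,1,0] True [4,6,5]) (Quad 0 4 5 6)) (Quad 0 1 5 6))) (Quad 0 1 5 6)))))"

text \<open>As in \<open>cert_odd\<close>, except that \<open>5\<close> to \<open>9\<close> are the
  last five path vertices and \<open>10\<close> is the outside vertex.\<close>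

definition cert_even :: cert where
  "cert_even =
    Split 9 10 (Path True [3,2,1,0] False [4,5,6,7,8,9,10]) (Split 10 0 (Path True [3,2,1,0,10]
    False [4,5,6,7,8,9]) (Split 9 0 (Split 1 10 (Path True [3,2] False [4,5,6,7,8,9,0,1,10])
    (Split 5 10 (Path True [3,2,1,0,9,8,7,6] False [4,5,10]) (Split 7 10 (Path True
    [3,2,1,0,9,8] False [4,5,6,7,10]) (Split 10 2 (Path True [3] False [4,5,6,7,8,9,0,1,2,10])
    (Split 10 4 (Path True [3,2,1,0,9,8,7,6,5] False [4,10]) (Split 10 6 (Path True
    [3,2,1,0,9,8,7] False [4,5,6,10]) (Split 10 8 (Path True [3,2,1,0,9] False [4,5,6,7,8,10])
    (Split 9 7 (Split 10 7 (Split 8 6 (Path True [3,2,1,0,9,7,10] False [4,5,6,8]) (Split 6 10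
    (Split 6 8 (Split 5 7 (Path True [3,2,1,0,9,8,6] False [4,5,7,10]) (Split 5 8 (Path True
    [3,2,1,0,9,7] False [4,5,8,6,10]) (Split 6 0 (Path True [3,2,1,0,6,8,9,7,10] False [4,5])
    (Split 0 10 (Split 7 5 (Split 8 10 (Split 8 5 (Split 1 7 (Path True [3,2,1,7,9,8,6,10,0]
    False [4,5]) (Split 9 5 (Path True [3,2,1,0,9,5,7,8,6,10] False [4]) (Split 9 6 (Path True
    [3,2,1,0,9,6,7,5,8,10] False [4]) (Split 10 1 (Split 10 9 (Split 6 9 (Split 5 9 (Split 0 8
    (Path True [3,2,1] False [4,5,9,6,10,0,8,7]) (Split 1 8 (Path True [3,2,1,8,7] False
    [4,5,9,6,10,0]) (Split 7 0 (Path True [3,2,1,0,7,8,6] False [4,5,9,10]) (Split 8 0 (Split 7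
    1 (Split 8 1 (Split 0 2 (Path True [3,2,0] False [4,5,9,10,1,7,8,6]) (Split 7 2 (Path True
    [3] False [4,5,9,6,10,8,0,1,2,7]) (Split 2 0 (Split 2 10 (Path True [3] False
    [4,5,6,7,1,8,10,2,0,9]) (Quad 0 1 2 10)) (Quad 0 1 2 7)))) (Quad 0 1 7 8)) (Quad 0 1 7 8))
    (Quad 0 1 6 8))))) (Quad 5 6 7 9)) (Quad 0 6 9 10)) (Quad 0 5 9 10)) (Quad 0 1 7 10)))))
    (Quad 5 6 8 10)) (Quad 5 6 8 10)) (Quad 5 6 7 10)) (Quad 0 1 6 10))))) (Quad 6 7 8 10))
    (Quad 5 6 8 10))) (Quad 6 7 9 10)) (Split 10 9 (Split 7 9 (Split 8 0 (Path True [3,2,1,0,8]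
    False [4,5,6,7,9,10]) (Split 0 10 (Split 0 8 (Split 0 6 (Path True [3,2,1] False
    [4,5,6,0,8,7,9,10]) (Split 1 8 (Path True [3,2,1,8,0] False [4,5,6,7,9,10]) (Split 1 9 (Path
    True [3,2,1,9] False [4,5,6,7,8,0,10]) (Split 8 1 (Split 8 10 (Split 9 1 (Split 10 1 (Split
    6 10 (Split 0 2 (Path True [3,2,0] False [4,5,6,7,8,9,1,10]) (Split 5 9 (Path True [3,2,1]
    False [4,5,9,7,8,0,10,6]) (Split 7 0 (Path True [3,2] False [4,5,6,7,0,9,1,8,10]) (Split 7 1
    (Path True [3,2] False [4,5,6,7,1,9,8,0,10]) (Split 2 0 (Split 0 7 (Split 1 7 (Split 10 5
    (Split 2 8 (Path True [3] False [4,5,6,7,8,2,0,9,1,10]) (Split 5 8 (Path True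
    [3,2,1,7,0,10,6] False [4,5,8,9]) (Split 6 8 (Path True [3,2,1,7,0,10,6,8,9] False [4,5])
    (Split 9 6 (Path True [3,2,1,7] False [4,5,6,9,8,0,10]) (Split 8 2 (Split 6 9 (Split 6 0
    (Split 8 5 (Path True [3,2,8,5,10,9,6,0,1,7] False [4]) (Quad 5 6 8 9)) (Quad 0 6 7 9))
    (Quad 0 6 7 9)) (Quad 0 1 2 8)))))) (Quad 4 5 9 10)) (Quad 0 1 7 8)) (Quad 0 1 7 8)) (Quad 0
    1 2 10)))))) (Quad 0 5 6 10)) (Quad 0 1 9 10)) (Quad 0 1 9 10)) (Quad 0 1 8 10)) (Quad 0 1 8
    10))))) (Quad 0 8 9 10)) (Quad 0 1 8 10))) (Quad 7 8 9 10)) (Quad 0 7 9 10)))))))))) (Split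
    0 9 (Split 0 8 (Split 1 10 (Path True [3,2,1,10] False [4,5,6,7,8,0,9]) (Split 10 9 (Path
    True [3,2,1] False [4,5,6,7,8,0,9,10]) (Split 1 9 (Split 10 8 (Path True [3,2,1,9,0] False
    [4,5,6,7,8,10]) (Quad 1 8 9 10)) (Quad 0 1 9 10)))) (Split 8 10 (Split 0 10 (Split 1 9 (Path
    True [3,2,1,9,0,10] False [4,5,6,7,8]) (Split 1 10 (Path True [3,2,1,10,0] False
    [4,5,6,7,8,9]) (Split 7 9 (Path True [3,2,1] False [4,5,6,7,9,0,10,8]) (Split 10 1 (Split 10
    9 (Split 0 2 (Path True [3,2,0,9,10,1] False [4,5,6,7,8]) (Split 1 8 (Split 8 0 (Split 9 1
    (Split 0 6 (Path True [3,2,1,8,7] False [4,5,6,0,9,10]) (Split 7 10 (Path True [3,2,1,8]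
    False [4,5,6,7,10,0,9]) (Split 10 2 (Path True [3,2,10,9] False [4,5,6,7,8,1,0]) (Split 2 0
    (Split 9 7 (Split 0 7 (Path True [3,2,1,8,9,7,0,10] False [4,5,6]) (Split 2 9 (Path True [3]
    False [4,5,6,7,8,1,0,2,9,10]) (Split 9 2 (Split 7 0 (Path True [3,2,9,1] False
    [4,5,6,7,0,8,10]) (Quad 0 6 7 9)) (Quad 0 1 2 9)))) (Quad 7 8 9 10)) (Quad 0 1 2 10)))))
    (Quad 1 8 9 10)) (Quad 0 1 8 10)) (Split 8 1 (Split 9 1 (Split 8 0 (Split 7 0 (Path True
    [3,2] False [4,5,6,7,0,8,1,10,9]) (Split 7 1 (Path True [3,2] False [4,5,6,7,1,8,10,0,9])
    (Split 8 2 (Path True [3,2,8,1,10,9,0] False [4,5,6,7]) (Split 9 2 (Path True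
    [3,2,9,1,8,10,0] False [4,5,6,7]) (Split 2 9 (Split 2 0 (Split 1 7 (Split 0 7 (Split 9 7
    (Split 2 8 (Split 0 6 (Path True [3,2] False [4,5,6,0,10,8,1,9,7]) (Split 8 6 (Path True
    [3,2,1,7] False [4,5,6,8,10,0,9]) (Split 9 6 (Path True [3,2,1,7,0,10] False [4,5,6,9,8])
    (Split 6 8 (Split 6 0 (Split 6 9 (Split 5 1 (Path True [3] False [4,5,1,10,9,2,0,6,8,7])
    (Split 5 7 (Path True [3] False [4,5,7,1,0,6,8,2,9,10]) (Split 5 8 (Path True
    [3,2,1,0,6,9,10] False [4,5,8,7]) (Split 5 9 (Path True [3,2,1,0,6,8,7] False [4,5,9,10])
    (Split 5 10 (Path True [3,2,1] False [4,5,10,0,9,6,8,7]) (Split 6 10 (Path True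
    [3,2,1,7,0,10,6,8,9] False [4,5]) (Split 10 6 (Split 8 5 (Split 7 5 (Path True
    [3,2,1,0,8,5,7,6,10,9] False [4]) (Quad 5 6 7 9)) (Quad 1 5 6 8)) (Quad 0 5 6 10))))))))
    (Quad 0 6 7 9)) (Quad 0 6 7 8)) (Quad 0 6 7 8))))) (Quad 1 2 8 9)) (Quad 0 7 8 9)) (Quad 0 7
    8 9)) (Quad 0 1 7 8)) (Quad 0 1 2 9)) (Quad 0 1 2 9)))))) (Quad 0 1 8 9)) (Quad 0 1 8 9))
    (Quad 0 1 8 9)))) (Quad 0 1 9 10)) (Quad 0 1 9 10))))) (Quad 0 8 9 10)) (Split 10 8 (Split
    10 9 (Path True [3,2,1] False [4,5,6,7,8,10,9,0]) (Quad 0 8 9 10)) (Quad 0 8 9 10)))) (Split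
    1 9 (Split 0 8 (Split 0 10 (Path True [3,2,1,9] False [4,5,6,7,8,0,10]) (Split 10 9 (Path
    True [3,2,1,9,10] False [4,5,6,7,8,0]) (Quad 0 1 9 10))) (Quad 0 8 9 10)) (Quad 0 1 9
    10)))))"

lemma path_cert_4: "path_cert 6 4 cert_4"
  by code_simp

lemma path_cert_5: "path_cert 6 5 cert_5"
  by code_simp

lemma path_cert_6: "path_cert 8 6 cert_6"
  by code_simp

lemma path_cert_8: "path_cert 9 8 cert_8"
  by code_simp

lemma window_cert_odd: "window_cert 3 1 True cert_odd"
  by code_simp

lemma window_cert_even: "window_cert 3 5 False cert_even"
  by code_simp

section \<open>Hamiltonian paths\<close>

context quad_traceable
begin

text \<open>The trees for whole paths assume that the path starts at a tail. The windows assume that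
  the vertex at index 3 is a tail, so there the path has to start at a head; the sign of the other
  end of the middle part then follows from the parity of \<open>p\<close>.\<close>

lemma extend_normalized:
  assumes "8 \<le> card V" "4 \<le> p" "p < card V"
    and zs: "successively (link A) zs" "distinct (map fst zs)" "fst ` set zs \<subseteq> V" "length zs = p"
    and sign: "snd (hd zs) \<longleftrightarrow> p \<in> {4, 5, 6, 8}"
  shows "has_path A V (Suc p)"
proof (cases "p \<in> {4, 5, 6, 8}")
  case True
  then consider "p = 4" | "p = 5" | "p = 6" | "p = 8" by blast
  then show ?thesis
    using path_cert_extends[OF _ zs] path_cert_4 path_cert_5 path_cert_6 path_cert_8 True sign
      assms(1,3) by cases auto
next
  case False
  then have p: "p = 7 \<or> 9 \<le> p"
    using assms(2) by auto
  have "card (fst ` set zs) = p"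
    using distinct_card[OF zs(2)] zs(4) by simp
  then obtain v where v: "v \<in> V - fst ` set zs"
    using assms(3) zs(3) by (metis DiffI less_irrefl subsetI subset_antisym)
  have sign_nth: "snd (zs ! i) \<longleftrightarrow> odd i" if "i < p" for i
    using link_path_sign[OF zs(1)] zs(4) that sign False by auto
  show ?thesis
  proof (cases "odd p")
    case True
    then have "snd (zs ! 3)" "snd (zs ! (p - Suc 1)) = True"
      using p by (auto simp: sign_nth)
    then show ?thesis
      using p v by (intro window_cert_extends[OF window_cert_odd zs]) auto
  next
    case even: False
    \<comment> \<open>The even window needs \<open>3 + 5 + 2 = 10\<close> path vertices, and
      evenness excludes \<open>p = 9\<close>.\<close>
    then have "9 \<le> p" "p \<noteq> 9" using p by auto
    then have "10 \<le> p" by linarith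
    then have "snd (zs ! 3)" "snd (zs ! (p - Suc 5)) = False"
      using even by (auto simp: sign_nth)
    then show ?thesis
      using \<open>10 \<le> p\<close> v by (intro window_cert_extends[OF window_cert_even zs]) auto
  qed
qed

text \<open>If the first vertex has the wrong sign, pass to the converse, where all signs are
  flipped, and transfer the longer path back.\<close>

lemma extend:
  assumes "8 \<le> card V" "4 \<le> p" "p < card V" "has_path A V p"
  shows "has_path A V (Suc p)"
proof -
  from assms(4) obtain zs where zs: "successively (link A) zs" "distinct (map fst zs)"
      "fst ` set zs \<subseteq> V" "length zs = p"
    unfolding has_path_def by blast
  show ?thesis
  proof (cases "snd (hd zs) \<longleftrightarrow> p \<in> {4, 5, 6, 8}")
    case True
    then show ?thesis
      using extend_normalized[OF assms(1-3) zs] by blast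
  next
    case False
    interpret converse: quad_traceable "A\<inverse>\<inverse>" V
      by (rule quad_traceable_converse)
    have ne: "zs \<noteq> []"
      using zs(4) assms(2) by auto
    have "has_path A\<inverse>\<inverse> V (Suc p)"
      by (rule converse.extend_normalized[OF assms(1-3), of "map (map_prod id Not) zs"])
         (use zs False ne in \<open>auto simp: link_path_converse comp_def hd_map map_prod_def
            case_prod_beta image_image\<close>)
    then show ?thesis
      by (rule has_path_converse)
  qed
qed

theorem has_hamiltonian_path:
  assumes "8 \<le> card V"
  shows "has_path A V (card V)"
proof -
  have "has_path A V p" if "4 \<le> p" "p \<le> card V" for p
    using that
  proof (induction p rule: dec_induct)
    case base
    have "4 \<le> card V"
      using assms by simp
    then obtain Q where Q: "Q \<subseteq> V" "card Q = 4"
      by (rule obtain_subset_with_card_n)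
    from quad[OF this] obtain w x y z where Q_eq: "Q = {w, x, y, z}" and "A w x" "A y x" "A y z"
      by blast
    then have "successively (link A) (signed True [w, x, y, z])"
      by (simp add: link_def)
    moreover have "distinct [w, x, y, z]"
      using Q(2) unfolding Q_eq by (intro card_distinct) simp
    moreover have "set [w, x, y, z] \<subseteq> V"
      using Q(1) unfolding Q_eq by simp
    ultimately show ?case
      unfolding has_path_def
      by (intro exI[of _ "signed True [w, x, y, z]"])
         (simp only: map_fst_signed fst_set_signed length_signed, simp)
  next
    case (step p)
    then show ?case
      using extend assms by simp
  qed
  then show ?thesis
    using assms by simp
qed

end

section \<open>Translation between oriented graphs and signed paths\<close>

lemma anti_traceable_iff_link_path:
  "anti_traceable H \<longleftrightarrow> (\<exists>zs. zs \<noteq> [] \<and> successively (link (\<lambda>u v. u \<rightarrow>\<^bsub>H\<^esub> v)) zs \<and>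
     distinct (map fst zs) \<and> fst ` set zs = verts H)"
proof
  assume "anti_traceable H"
  then obtain xs es where len: "length xs = Suc (length es)" and xs: "distinct xs" "set xs = verts H"
    and es: "set es \<subseteq> arcs H"
    and ends: "\<And>i. i < length es \<Longrightarrow> {tail H (es ! i), head H (es ! i)} = {xs ! i, xs ! Suc i}"
    and alt: "\<And>i. Suc i < length es \<Longrightarrow>
      (tail H (es ! i) = xs ! i \<longleftrightarrow> tail H (es ! Suc i) \<noteq> xs ! Suc i)"
    unfolding anti_traceable_def anti_directed_path_def oriented_path_def by blast
  \<comment> \<open>The direction of the first arc fixes the sign of the first vertex. For a
    one-vertex path there is no such arc, and either value of \<open>s\<close> works.\<close>
  define s where "s \<longleftrightarrow> tail H (es ! 0) = xs ! 0"
  have sign: "tail H (es ! i) = xs ! i \<longleftrightarrow> s = even i" if "i < length es" for i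
    using that
  proof (induction i)
    case (Suc i)
    then show ?case using alt[of i] by auto
  qed (simp add: s_def)
  have arc: "tail H (es ! i) \<rightarrow>\<^bsub>H\<^esub> head H (es ! i)" if "i < length es" for i
    using es that nth_mem by (fastforce simp: arcs_ends_conv)
  have "link (\<lambda>u v. u \<rightarrow>\<^bsub>H\<^esub> v) (signed s xs ! i) (signed s xs ! Suc i)" if "Suc i < length xs" for i
    using that len arc[of i] ends[of i] sign[of i]
    by (auto simp: link_def nth_signed doubleton_eq_iff)
  then have "successively (link (\<lambda>u v. u \<rightarrow>\<^bsub>H\<^esub> v)) (signed s xs)"
    by (simp add: successively_conv_nth)
  then show "\<exists>zs. zs \<noteq> [] \<and> successively (link (\<lambda>u v. u \<rightarrow>\<^bsub>H\<^esub> v)) zs \<and>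
     distinct (map fst zs) \<and> fst ` set zs = verts H"
    using xs len by (intro exI[of _ "signed s xs"]) (auto simp flip: length_0_conv)
next
  assume "\<exists>zs. zs \<noteq> [] \<and> successively (link (\<lambda>u v. u \<rightarrow>\<^bsub>H\<^esub> v)) zs \<and>
     distinct (map fst zs) \<and> fst ` set zs = verts H"
  then obtain zs where zs: "zs \<noteq> []" "successively (link (\<lambda>u v. u \<rightarrow>\<^bsub>H\<^esub> v)) zs"
      "distinct (map fst zs)" "fst ` set zs = verts H"
    by blast
  define m where "m = length zs - 1"
  have len: "length zs = Suc m"
    using zs(1) by (simp add: m_def)
  have "\<exists>e. e \<in> arcs H \<and> (if snd (zs ! i)
      then tail H e = fst (zs ! i) \<and> head H e = fst (zs ! Suc i)
      else tail H e = fst (zs ! Suc i) \<and> head H e = fst (zs ! i))" if "i < m" for i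
    using successively_nth[OF zs(2), of i] that len by (force simp: link_def arcs_ends_conv)
  then obtain e where e: "\<And>i. i < m \<Longrightarrow> e i \<in> arcs H \<and> (if snd (zs ! i)
      then tail H (e i) = fst (zs ! i) \<and> head H (e i) = fst (zs ! Suc i)
      else tail H (e i) = fst (zs ! Suc i) \<and> head H (e i) = fst (zs ! i))"
    by metis
  \<comment> \<open>Consecutive vertices differ, so an arc cannot have its tail at both of them;
    this makes the sign of a vertex decide whether the next arc is a forward arc.\<close>
  have neq: "fst (zs ! i) \<noteq> fst (zs ! Suc i)" if "i < m" for i
    using zs(3) that len nth_eq_iff_index_eq[of "map fst zs" i "Suc i"] by auto
  have alt: "snd (zs ! Suc i) \<longleftrightarrow> \<not> snd (zs ! i)" if "i < m" for i
    using successively_nth[OF zs(2), of i] that len by (auto simp: link_def)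
  have tail: "tail H (e i) = fst (zs ! i) \<longleftrightarrow> snd (zs ! i)" if "i < m" for i
    using e[OF that] neq[OF that] by (auto split: if_splits)
  have ends: "{tail H (e i), head H (e i)} = {fst (zs ! i), fst (zs ! Suc i)}" if "i < m" for i
    using e[OF that] by (auto split: if_splits)
  have "anti_directed_path H (map fst zs) (map e [0..<m])"
    unfolding anti_directed_path_def oriented_path_def
    using zs(3,4) e ends tail alt len by (auto simp: nth_append simp del: upt_Suc)
  then show "anti_traceable H"
    using zs(4) unfolding anti_traceable_def by (metis set_map)
qed

lemma oriented_graph_quad_traceable:
  assumes "oriented_graph G" "k_anti_traceable 4 G"
  shows "quad_traceable (\<lambda>u v. u \<rightarrow>\<^bsub>G\<^esub> v) (verts G)"
proof
  show "finite (verts G)"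
    using assms(1) by (simp add: oriented_graph_def)
next
  fix u v assume "u \<rightarrow>\<^bsub>G\<^esub> v"
  then show "\<not> v \<rightarrow>\<^bsub>G\<^esub> u"
    using assms(1) by (simp add: oriented_graph_iff)
next
  fix Q assume Q: "Q \<subseteq> verts G" "card Q = 4"
  then have "anti_traceable (G \<restriction> Q)"
    using assms(2) by (simp add: k_anti_traceable_def)
  then obtain zs where zs: "successively (link (\<lambda>u v. u \<rightarrow>\<^bsub>G \<restriction> Q\<^esub> v)) zs"
      "distinct (map fst zs)" "fst ` set zs = Q"
    by (auto simp: anti_traceable_iff_link_path)
  then have "length zs = Suc (Suc (Suc (Suc 0)))"
    using distinct_card[OF zs(2)] Q(2) by simp
  then obtain a b c d where abcd: "zs = [a, b, c, d]"
    by (auto simp: length_Suc_conv)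
  have arc: "u \<rightarrow>\<^bsub>G\<^esub> v" if "u \<rightarrow>\<^bsub>G \<restriction> Q\<^esub> v" for u v
    using that by (auto simp: arcs_ends_conv)
  show "\<exists>w x y z. Q = {w, x, y, z} \<and> w \<rightarrow>\<^bsub>G\<^esub> x \<and> y \<rightarrow>\<^bsub>G\<^esub> x \<and> y \<rightarrow>\<^bsub>G\<^esub> z"
  \<comment> \<open>A path that starts at a head ends at a tail and is read backwards.\<close>
  proof (cases "snd a")
    case True
    then have "Q = {fst a, fst b, fst c, fst d} \<and> fst a \<rightarrow>\<^bsub>G\<^esub> fst b \<and> fst c \<rightarrow>\<^bsub>G\<^esub> fst b \<and>
        fst c \<rightarrow>\<^bsub>G\<^esub> fst d"
      using zs(1,3) unfolding abcd by (auto simp: link_def intro: arc)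
    then show ?thesis by blast
  next
    case False
    then have "Q = {fst d, fst c, fst b, fst a} \<and> fst d \<rightarrow>\<^bsub>G\<^esub> fst c \<and> fst b \<rightarrow>\<^bsub>G\<^esub> fst c \<and>
        fst b \<rightarrow>\<^bsub>G\<^esub> fst a"
      using zs(1,3) unfolding abcd by (auto simp: link_def intro: arc)
    then show ?thesis by blast
  qed
qed

lemma four_anti_traceable_imp_anti_traceable:
  assumes "oriented_graph G" "k_anti_traceable 4 G" "8 \<le> card (verts G)"
  shows "anti_traceable G"
proof -
  interpret quad_traceable "\<lambda>u v. u \<rightarrow>\<^bsub>G\<^esub> v" "verts G"
    using assms by (intro oriented_graph_quad_traceable)
  obtain zs where zs: "successively (link (\<lambda>u v. u \<rightarrow>\<^bsub>G\<^esub> v)) zs" "distinct (map fst zs)"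
      "fst ` set zs \<subseteq> verts G" "length zs = card (verts G)"
    using has_hamiltonian_path[OF assms(3)] unfolding has_path_def by blast
  have "card (fst ` set zs) = card (verts G)"
    using distinct_card[OF zs(2)] zs(4) by simp
  then have "fst ` set zs = verts G"
    using zs(3) finite_V by (simp add: card_subset_eq)
  then show ?thesis
    using zs assms(3) unfolding anti_traceable_iff_link_path by (intro exI[of _ zs]) auto
qed

section \<open>The Paley tournament on seven vertices\<close>

text \<open>The numbers 1, 2 and 4 are the nonzero squares modulo 7. Adding 7 prevents the
  subtraction of naturals from being cut off at 0.\<close>

definition paley_arc :: "nat \<Rightarrow> nat \<Rightarrow> bool" where
  "paley_arc u v \<longleftrightarrow> u < 7 \<and> v < 7 \<and> (v + 7 - u) mod 7 \<in> {1, 2, 4}"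

text \<open>The arc from \<open>u\<close> to \<open>v\<close> is encoded as the number
  \<open>7 * u + v\<close>, so that arcs are natural numbers too.\<close>

definition paley_7 :: "(nat, nat) pre_digraph" where
  "paley_7 = \<lparr>verts = {..<7}, arcs = {e. paley_arc (e div 7) (e mod 7)},
     tail = (\<lambda>e. e div 7), head = (\<lambda>e. e mod 7)\<rparr>"

lemma verts_paley_7 [simp]: "verts paley_7 = {..<7}"
  by (simp add: paley_7_def)

lemma paley_7_arc_iff [simp]: "u \<rightarrow>\<^bsub>paley_7\<^esub> v \<longleftrightarrow> paley_arc u v"
proof
  assume "paley_arc u v"
  then have "v < 7" "(7 * u + v) div 7 = u" "(7 * u + v) mod 7 = v"
    by (auto simp: paley_arc_def)
  with \<open>paley_arc u v\<close> show "u \<rightarrow>\<^bsub>paley_7\<^esub> v"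
    unfolding arcs_ends_conv paley_7_def by (intro image_eqI[of _ _ "7 * u + v"]) auto
qed (auto simp: arcs_ends_conv paley_7_def)

text \<open>The reason is that -1 is not a square modulo 7; here the 49 pairs are simply
  evaluated.\<close>

lemma paley_arc_asym:
  assumes "paley_arc u v"
  shows "\<not> paley_arc v u"
proof -
  have "\<forall>u\<in>set [0..<7]. \<forall>v\<in>set [0..<7]. paley_arc u v \<longrightarrow> \<not> paley_arc v u"
    by code_simp
  moreover have "u \<in> set [0..<7]" "v \<in> set [0..<7]"
    using assms by (simp_all add: paley_arc_def)
  ultimately show ?thesis
    using assms by blast
qed

lemma oriented_graph_paley_7: "oriented_graph paley_7"
proof -
  have "arcs paley_7 \<subseteq> {..<49}"
    by (auto simp: paley_7_def paley_arc_def)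
  then have "finite (arcs paley_7)"
    using finite_subset by blast
  moreover have "tail paley_7 e \<in> verts paley_7" "head paley_7 e \<in> verts paley_7"
    "tail paley_7 e \<noteq> head paley_7 e" if "e \<in> arcs paley_7" for e
    using that by (auto simp: paley_7_def paley_arc_def)
  moreover have "a = b" if "arc_to_ends paley_7 a = arc_to_ends paley_7 b" for a b
  proof -
    have "a div 7 = b div 7" "a mod 7 = b mod 7"
      using that by (simp_all add: arc_to_ends_def paley_7_def)
    then show ?thesis
      by (metis div_mult_mod_eq)
  qed
  ultimately have "digraph paley_7"
    by unfold_locales (blast | simp)+
  then show ?thesis
    using paley_arc_asym by (simp add: oriented_graph_iff)
qed

lemma four_anti_traceable_paley_7: "k_anti_traceable 4 paley_7"
  unfolding k_anti_traceable_def
proof (intro conjI allI impI)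
  fix S assume S: "S \<subseteq> verts paley_7 \<and> card S = 4"
  \<comment> \<open>Subsets become subsequences of \<open>[0..<7]\<close>, over which the search
    below can be evaluated.\<close>
  then have "S \<in> set ` set (subseqs [0..<7])"
    unfolding subseqs_powset by auto
  then obtain ys where ys: "ys \<in> set (subseqs [0..<7])" "set ys = S"
    by blast
  then have "length ys = 4"
    using S subseqs_distinctD[OF ys(1)] distinct_card by fastforce
  moreover have "\<forall>ys\<in>set (subseqs [0..<7]). length ys = 4 \<longrightarrow>
      (\<exists>y\<in>set ys. \<exists>x\<in>set ys. paley_arc y x \<and> (\<exists>w\<in>set ys. paley_arc w x \<and> w \<noteq> y \<and>
        (\<exists>z\<in>set ys. paley_arc y z \<and> z \<noteq> x \<and> z \<noteq> w)))"
    by code_simp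
  ultimately obtain w x y z where wxyz: "{w, x, y, z} \<subseteq> S"
      "paley_arc w x" "paley_arc y x" "paley_arc y z" "w \<noteq> y" "z \<noteq> x" "z \<noteq> w"
    using ys by blast
  \<comment> \<open>Adjacent vertices differ because 0 is not among the differences 1, 2, 4; the
    other three inequalities come from the search.\<close>
  then have dist: "distinct [w, x, y, z]"
    by (auto simp: paley_arc_def)
  then have "card {w, x, y, z} = 4"
    by simp
  then have eq: "{w, x, y, z} = S"
    using wxyz(1) S by (intro card_subset_eq) (auto intro: finite_subset)
  have arc: "u \<rightarrow>\<^bsub>paley_7 \<restriction> S\<^esub> v" if "paley_arc u v" "u \<in> S" "v \<in> S" for u v
  proof -
    from that have "u \<rightarrow>\<^bsub>paley_7\<^esub> v" by simp
    then show ?thesis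
      using that(2,3) by (auto simp: arcs_ends_conv)
  qed
  have "successively (link (\<lambda>u v. u \<rightarrow>\<^bsub>paley_7 \<restriction> S\<^esub> v)) (signed True [w, x, y, z])"
    using wxyz by (simp add: link_def arc)
  then show "anti_traceable (paley_7 \<restriction> S)"
    unfolding anti_traceable_iff_link_path
    using dist eq by (intro exI[of _ "signed True [w, x, y, z]"]) simp
qed simp

text \<open>A backtracking search for a hamiltonian path: \<open>p\<close> is the signed vertex
  placed last and the list holds the vertices still to be visited.\<close>

function completable :: "('a \<Rightarrow> 'a \<Rightarrow> bool) \<Rightarrow> 'a \<times> bool \<Rightarrow> 'a list \<Rightarrow> bool" where
  "completable A p [] \<longleftrightarrow> True"
| "completable A p (u # us) \<longleftrightarrow> (\<exists>y\<in>set (u # us). link A p (y, \<not> snd p) \<and>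
     completable A (y, \<not> snd p) (remove1 y (u # us)))"
  by pat_completeness auto
termination
  by (relation "measure (\<lambda>(_, _, us). length us)") (auto simp: length_remove1 dest: length_pos_if_in_set)

text \<open>A given path is itself one branch of the search, so a failing search rules the path
  out.\<close>

lemma link_path_imp_completable:
  assumes "successively (link A) (z # zs)" "distinct (map fst zs)" "distinct us"
    "fst ` set zs = set us"
  shows "completable A z us"
  using assms
proof (induction zs arbitrary: z us)
  case (Cons q zs)
  obtain u us' where us: "us = u # us'"
    using Cons.prems(4) by (cases us) auto
  have "link A z q"
    using Cons.prems(1) by simp
  then have q: "q = (fst q, \<not> snd z)"
    by (auto simp: link_def prod_eq_iff)
  have "fst ` set zs = set us - {fst q}"
    using Cons.prems(2) by (simp flip: Cons.prems(4))
  then have "completable A q (remove1 (fst q) us)"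
    using Cons.prems(1-3) by (intro Cons.IH) auto
  moreover have "fst q \<in> set us"
    using Cons.prems(4) by auto
  ultimately show ?case
    using \<open>link A z q\<close> q unfolding us completable.simps by metis
qed simp

lemma not_anti_traceable_paley_7: "\<not> anti_traceable paley_7"
proof
  assume "anti_traceable paley_7"
  then obtain z zs where zs: "successively (link paley_arc) (z # zs)" "distinct (map fst (z # zs))"
      "fst ` set (z # zs) = {..<7}"
    unfolding anti_traceable_iff_link_path by (auto simp: neq_Nil_conv)
  have "fst ` set zs = {..<7} - {fst z}"
    using zs(2) by (simp flip: zs(3))
  then have "completable paley_arc z (remove1 (fst z) [0..<7])"
    using zs(1,2) by (intro link_path_imp_completable) (auto simp: lessThan_atLeast0)
  moreover have "fst z \<in> set [0..<7]" "snd z \<in> set [True, False]"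
    using zs(3) by auto
  \<comment> \<open>The search fails from all 14 combinations of a first vertex and its
    sign.\<close>
  moreover have "\<forall>x\<in>set [0..<7]. \<forall>s\<in>set [True, False].
      \<not> completable paley_arc (x, s) (remove1 x [0..<7])"
    by code_simp
  ultimately show False
    by (metis prod.collapse)
qed

theorem theorem4:
  shows "f 4 = 8 \<and>
    (\<forall>G :: ('a, 'b) pre_digraph.
       oriented_graph G \<and> k_anti_traceable 4 G \<and> 8 \<le> card (verts G) \<longrightarrow> anti_traceable G) \<and>
    (\<exists>G :: (nat, nat) pre_digraph.
       oriented_graph G \<and> k_anti_traceable 4 G \<and> card (verts G) = 7 \<and> \<not> anti_traceable G)"
proof (intro conjI)
  show "f 4 = 8"
    unfolding f_def
  proof (rule Least_equality)
    show "anti_traceability_bound 4 8"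
      using four_anti_traceable_imp_anti_traceable by (auto simp: anti_traceability_bound_def)
  next
    fix m assume "anti_traceability_bound 4 m"
    then have "\<not> m \<le> card (verts paley_7)"
      using oriented_graph_paley_7 four_anti_traceable_paley_7 not_anti_traceable_paley_7
      unfolding anti_traceability_bound_def by blast
    then show "8 \<le> m"
      by simp
  qed
  show "\<exists>G :: (nat, nat) pre_digraph.
      oriented_graph G \<and> k_anti_traceable 4 G \<and> card (verts G) = 7 \<and> \<not> anti_traceable G"
    using oriented_graph_paley_7 four_anti_traceable_paley_7 not_anti_traceable_paley_7
    by (intro exI[of _ paley_7]) simp
qed (use four_anti_traceable_imp_anti_traceable in blast)

end
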